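(* Let $F\colon U\times\dots\times U\to\mathbb{K}$ be an $n$-linear form with $n\ge 3$ on a finite-dimensional vector space $U$ over a field $\mathbb{K}$. If \[ F=F_1\oplus\dots\oplus F_s\oplus 0 \] and the summands $F_1,\dots,F_s$ are nonzero and indecomposable, then these summands are determined by $F$ uniquely up to congruence. Moreover, if $U=U_1\oplus\dots\oplus U_s\oplus U_0$ is the corresponding decomposition of $U$, then the sequence of subspaces \[ U_1+U_0,\ \dots,\ U_s+U_0,\ U_0 \] is determined by $F$ uniquely up to permutations of $U_1+U_0,\dots,U_s+U_0$. Explicitly: if $F=G_1\oplus\dots\oplus G_r\oplus 0$ is another decomposition with $G_1,\dots,G_r$ nonzero and indecomposable, and $U=V_1\oplus\dots\oplus V_r\oplus V_0$ is the corresponding decomposition of $U$, then $r=s$, $V_0=U_0$, and, after a suitable reindexing of $G_1,\dots,G_r$, the form $F_i$ is congruent to $G_i$ and $U_i+U_0=V_i+V_0$ for all $i=1,\dots,s$.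
   Context: An $n$-linear form on a finite-dimensional vector space $U$ over a field $\mathbb{K}$ is a map $F\colon U\times\dots\times U\to\mathbb{K}$ ($n$ factors) that is linear in each argument. Two $n$-linear forms $F$ on $U$ and $G$ on $V$ are congruent if there is a linear bijection $\varphi\colon U\to V$ with $F(u_1,\dots,u_n)=G(\varphi u_1,\dots,\varphi u_n)$ for all $u_1,\dots,u_n\in U$. Direct sums are internal: $F=F_1\oplus\dots\oplus F_k$ means that there is a decomposition $U=U_1\oplus\dots\oplus U_k$ (the corresponding decomposition) such that $F(x_1,\dots,x_n)=0$ whenever $x_i\in U_p$ and $x_j\in U_q$ for some $i,j$ and some $p\ne q$, and $F_p=F|U_p$ is the restriction of $F$ to $U_p$ for each $p$. The last summand $0$ in the decompositions of the claim is the zero form on the (possibly zero) subspace $U_0$ (respectively $V_0$). A form $F$ on $U$ is indecomposable if for each decomposition $F=F_1\oplus F_2$ with corresponding decomposition $U=U_1\oplus U_2$ we have $U_1=0$ or $U_2=0$. *)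

theory Defs
  imports Complex_Main "HOL-Library.FuncSet" "HOL-Library.Set_Algebras"
begin

text \<open>
  A vector space over a field \<open>'k\<close> is given by a scalar multiplication \<open>scale\<close> with
  \<^locale>\<open>vector_space\<close>; the spaces that carry forms are subspaces of the type \<open>'v\<close>.
  The arguments of an \<open>n\<close>-linear form are the entries of a list of length \<open>n\<close>, and the values
  of a form on \<open>U\<close> outside \<open>tuples n U\<close> are irrelevant to every notion below.
\<close>

definition tuples :: "nat \<Rightarrow> 'v set \<Rightarrow> 'v list set" where
  "tuples n U = {xs. set xs \<subseteq> U \<and> length xs = n}"

definition multilinear_form ::
    "('k::field \<Rightarrow> 'v::ab_group_add \<Rightarrow> 'v) \<Rightarrow> nat \<Rightarrow> 'v set \<Rightarrow> ('v list \<Rightarrow> 'k) \<Rightarrow> bool" where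
  "multilinear_form scale n U F \<longleftrightarrow>
     (\<forall>xs\<in>tuples n U. \<forall>i<n.
        (\<forall>a\<in>U. \<forall>b\<in>U. F (xs[i := a + b]) = F (xs[i := a]) + F (xs[i := b])) \<and>
        (\<forall>c. \<forall>a\<in>U. F (xs[i := scale c a]) = c * F (xs[i := a])))"

definition zero_form :: "nat \<Rightarrow> 'v set \<Rightarrow> ('v list \<Rightarrow> 'k::field) \<Rightarrow> bool" where
  "zero_form n U F \<longleftrightarrow> (\<forall>xs\<in>tuples n U. F xs = 0)"

definition linear_bijection ::
    "('k::field \<Rightarrow> 'v::ab_group_add \<Rightarrow> 'v) \<Rightarrow> 'v set \<Rightarrow> 'v set \<Rightarrow> ('v \<Rightarrow> 'v) \<Rightarrow> bool" where
  "linear_bijection scale U V \<phi> \<longleftrightarrow>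
     (\<forall>a\<in>U. \<forall>b\<in>U. \<phi> (a + b) = \<phi> a + \<phi> b) \<and>
     (\<forall>c. \<forall>a\<in>U. \<phi> (scale c a) = scale c (\<phi> a)) \<and>
     bij_betw \<phi> U V"

definition congruent_forms ::
    "('k::field \<Rightarrow> 'v::ab_group_add \<Rightarrow> 'v) \<Rightarrow> nat \<Rightarrow>
     'v set \<Rightarrow> ('v list \<Rightarrow> 'k) \<Rightarrow> 'v set \<Rightarrow> ('v list \<Rightarrow> 'k) \<Rightarrow> bool" where
  "congruent_forms scale n U F V G \<longleftrightarrow>
     (\<exists>\<phi>. linear_bijection scale U V \<phi> \<and> (\<forall>xs\<in>tuples n U. F xs = G (map \<phi> xs)))"

definition direct_sum ::
    "('k::field \<Rightarrow> 'v::ab_group_add \<Rightarrow> 'v) \<Rightarrow> 'v set \<Rightarrow> 'i set \<Rightarrow> ('i \<Rightarrow> 'v set) \<Rightarrow> bool" where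
  "direct_sum scale U I W \<longleftrightarrow>
     finite I \<and> (\<forall>p\<in>I. module.subspace scale (W p) \<and> W p \<subseteq> U) \<and>
     (\<forall>u\<in>U. \<exists>!w. w \<in> (\<Pi>\<^sub>E p\<in>I. W p) \<and> u = (\<Sum>p\<in>I. w p))"

text \<open>
  \<open>form_direct_sum scale n U F I W G\<close> says that \<open>F\<close> is the internal direct sum of the forms
  \<open>G p\<close> on \<open>W p\<close>, \<open>p \<in> I\<close>, where the \<open>W p\<close> form the corresponding decomposition of \<open>U\<close>.
\<close>

definition form_direct_sum ::
    "('k::field \<Rightarrow> 'v::ab_group_add \<Rightarrow> 'v) \<Rightarrow> nat \<Rightarrow> 'v set \<Rightarrow> ('v list \<Rightarrow> 'k) \<Rightarrow>
     'i set \<Rightarrow> ('i \<Rightarrow> 'v set) \<Rightarrow> ('i \<Rightarrow> 'v list \<Rightarrow> 'k) \<Rightarrow> bool" where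
  "form_direct_sum scale n U F I W G \<longleftrightarrow>
     direct_sum scale U I W \<and>
     (\<forall>xs\<in>tuples n U. \<forall>p\<in>I. \<forall>q\<in>I. \<forall>i<n. \<forall>j<n.
        p \<noteq> q \<and> xs ! i \<in> W p \<and> xs ! j \<in> W q \<longrightarrow> F xs = 0) \<and>
     (\<forall>p\<in>I. \<forall>xs\<in>tuples n (W p). G p xs = F xs)"

definition indecomposable_form ::
    "('k::field \<Rightarrow> 'v::ab_group_add \<Rightarrow> 'v) \<Rightarrow> nat \<Rightarrow> 'v set \<Rightarrow> ('v list \<Rightarrow> 'k) \<Rightarrow> bool" where
  "indecomposable_form scale n U F \<longleftrightarrow>
     (\<forall>(W :: nat \<Rightarrow> 'v set) G.
        form_direct_sum scale n U F {1, 2} W G \<longrightarrow> W 1 = {0} \<or> W 2 = {0})"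

end

theory Submission imports Defs begin

text \<open>
  The radical \<open>R\<close> of \<open>F\<close> consists of the vectors that annihilate \<open>F\<close> in every argument. A nonzero
  indecomposable form has radical \<open>0\<close>, since its radical could be split off as a zero summand. Hence
  the zero summand of any decomposition as in the theorem is \<open>R\<close> itself
  (\<open>radical_eq_summand\<close>), and this already gives \<open>U\<^sub>0 = V\<^sub>0\<close>.

  The rest is a commutation argument. Call a linear operator \<open>T\<close> central if \<open>F(\<dots>, T x\<^sub>i, \<dots>)\<close>, with
  \<open>T\<close> applied to a single argument, does not depend on the position \<open>i\<close>. Central operators correspond
  to decompositions: the projections \<open>P\<^sub>i\<close> onto the summands of a decomposition of \<open>F\<close> are central
  (\<open>component_in_centroid\<close>), and conversely a central idempotent splits \<open>F\<close> along its image and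
  kernel, so on an indecomposable form it is \<open>0\<close> or the identity (\<open>indecomposable_idempotent\<close>).
  With at least three arguments, two central operators that start in the same position can be
  moved apart to two other positions and brought back in the opposite order; so they commute
  modulo \<open>R\<close> (\<open>centroid_commute\<close>). For \<open>n = 2\<close> there is no third position, and the
  summands need not be determined modulo \<open>R\<close>: a scalar product has many orthogonal bases.

  Let \<open>P\<^sub>i\<close> and \<open>Q\<^sub>j\<close> be the projections of two decompositions. By commutation modulo \<open>R\<close>, each
  \<open>P\<^sub>i Q\<^sub>j\<close> with \<open>i, j \<ge> 1\<close> restricts to a central idempotent of the indecomposable form on \<open>U\<^sub>i\<close>, hence
  to \<open>0\<close> or the identity. Since \<open>\<Sum>\<^sub>j P\<^sub>i Q\<^sub>j = P\<^sub>i\<close> and \<open>P\<^sub>i\<close> kills \<open>V\<^sub>0 = R\<close>, some \<open>j \<ge> 1\<close> gives the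
  identity on \<open>U\<^sub>i\<close>, and then \<open>Q\<^sub>j x \<equiv> x\<close> modulo \<open>R\<close> for all \<open>x \<in> U\<^sub>i\<close> (\<open>exists_match\<close>). Exchanging the
  two decompositions gives a map from the indices \<open>j\<close> back to the indices \<open>i\<close>, and the two maps are
  mutually inverse (\<open>match_back\<close>). For a matched pair, \<open>Q\<^sub>j\<close> and \<open>P\<^sub>i\<close> are inverse bijections between
  \<open>U\<^sub>i\<close> and \<open>V\<^sub>j\<close>; they move vectors only by elements of \<open>R\<close>, so they preserve \<open>F\<close> and the sums with \<open>R\<close>.
\<close>

section \<open>Radical, central operators and components\<close>

definition radical :: "nat \<Rightarrow> 'v set \<Rightarrow> ('v list \<Rightarrow> 'k::field) \<Rightarrow> 'v set" where
  "radical n U F = {u \<in> U. \<forall>xs\<in>tuples n U. \<forall>i<n. F (xs[i := u]) = 0}"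

text \<open>
  The operators are functions on the whole type, and their behaviour outside \<open>U\<close> is left open; this
  makes a centroid element of \<open>F\<close> directly comparable with one of a restriction of \<open>F\<close>.
\<close>

definition centroid ::
    "('k::field \<Rightarrow> 'v::ab_group_add \<Rightarrow> 'v) \<Rightarrow> nat \<Rightarrow> 'v set \<Rightarrow> ('v list \<Rightarrow> 'k) \<Rightarrow> ('v \<Rightarrow> 'v) set" where
  "centroid scale n U F = {T. T \<in> U \<rightarrow> U \<and>
     (\<forall>a\<in>U. \<forall>b\<in>U. T (a + b) = T a + T b) \<and>
     (\<forall>c. \<forall>a\<in>U. T (scale c a) = scale c (T a)) \<and>
     (\<forall>xs\<in>tuples n U. \<forall>i<n. \<forall>j<n. F (xs[i := T (xs ! i)]) = F (xs[j := T (xs ! j)]))}"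

text \<open>
  The projection onto \<open>W p\<close> along the other summands. The definite description is proper for
  \<open>u \<in> U\<close> when \<open>U\<close> is the direct sum of the \<open>W q\<close>, \<open>q \<in> I\<close>.
\<close>

definition component :: "'i set \<Rightarrow> ('i \<Rightarrow> 'v::comm_monoid_add set) \<Rightarrow> 'i \<Rightarrow> 'v \<Rightarrow> 'v" where
  "component I W p u = (THE w. w \<in> (\<Pi>\<^sub>E q\<in>I. W q) \<and> u = (\<Sum>q\<in>I. w q)) p"

lemma tuples_nth: "xs \<in> tuples n U \<Longrightarrow> i < n \<Longrightarrow> xs ! i \<in> U"
  by (auto simp: tuples_def)

lemma tuples_length: "xs \<in> tuples n U \<Longrightarrow> length xs = n"
  by (simp add: tuples_def)

lemma tuples_update: "xs \<in> tuples n U \<Longrightarrow> a \<in> U \<Longrightarrow> xs[i := a] \<in> tuples n U"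
  using set_update_subset_insert[of xs i a] by (auto simp: tuples_def)

lemma tuples_map: "xs \<in> tuples n U \<Longrightarrow> (\<And>x. x \<in> U \<Longrightarrow> f x \<in> V) \<Longrightarrow> map f xs \<in> tuples n V"
  by (auto simp: tuples_def)

lemma tuples_mono: "U \<subseteq> V \<Longrightarrow> tuples n U \<subseteq> tuples n V"
  by (auto simp: tuples_def)

text \<open>
  Arguments of \<open>F\<close> are changed from \<open>xs\<close> to \<open>ys\<close> one position at a time, from left to right. The
  intermediate tuples only mix entries of \<open>xs\<close> and \<open>ys\<close> position by position; the step may rely on
  this, for instance to know that an entry at which \<open>xs\<close> and \<open>ys\<close> agree is still in place.
\<close>

lemma eq_by_replacing_entries:
  assumes xs: "xs \<in> tuples n U" and ys: "ys \<in> tuples n U"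
    and step: "\<And>k zs. k < n \<Longrightarrow> zs \<in> tuples n U \<Longrightarrow> \<forall>m<n. zs ! m \<in> {xs ! m, ys ! m} \<Longrightarrow>
                 zs ! k = xs ! k \<Longrightarrow> F (zs[k := ys ! k]) = F zs"
  shows "F ys = F xs"
proof -
  have len: "length xs = n" "length ys = n"
    using xs ys by (auto simp: tuples_length)
  have "m \<le> n \<Longrightarrow> F (take m ys @ drop m xs) = F xs" for m
  proof (induction m)
    case (Suc m)
    let ?zs = "take m ys @ drop m xs"
    have mixed: "?zs ! k = (if k < m then ys ! k else xs ! k)" if "k < n" for k
      using that Suc.prems len by (auto simp: nth_append)
    have "?zs \<in> tuples n U"
      using xs ys Suc.prems set_take_subset[of m ys] set_drop_subset[of m xs]
      by (auto simp: tuples_def)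
    moreover have "?zs[m := ys ! m] = take (Suc m) ys @ drop (Suc m) xs"
      using Suc.prems len
      by (intro nth_equalityI) (auto simp: nth_append nth_list_update less_Suc_eq)
    ultimately show ?case
      using step[of m ?zs] mixed Suc by auto
  qed simp
  from this[of n] show ?thesis
    using len by simp
qed

context vector_space
begin

lemma
  assumes "direct_sum scale U I W" and "u \<in> U"
  shows component_mem: "p \<in> I \<Longrightarrow> component I W p u \<in> W p"
    and sum_component: "(\<Sum>p\<in>I. component I W p u) = u"
proof -
  have "\<exists>!w. w \<in> (\<Pi>\<^sub>E p\<in>I. W p) \<and> u = (\<Sum>p\<in>I. w p)"
    using assms by (auto simp: direct_sum_def)
  from theI'[OF this] show "p \<in> I \<Longrightarrow> component I W p u \<in> W p"
    and "(\<Sum>p\<in>I. component I W p u) = u"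
    by (auto simp: component_def)
qed

lemma component_unique:
  assumes "direct_sum scale U I W" and "(\<Sum>q\<in>I. w q) \<in> U"
    and "\<And>q. q \<in> I \<Longrightarrow> w q \<in> W q" and "p \<in> I"
  shows "component I W p (\<Sum>q\<in>I. w q) = w p"
proof -
  let ?u = "\<Sum>q\<in>I. w q"
  have "\<exists>!w. w \<in> (\<Pi>\<^sub>E p\<in>I. W p) \<and> ?u = (\<Sum>p\<in>I. w p)"
    using assms(1,2) by (auto simp: direct_sum_def)
  then have "(THE w. w \<in> (\<Pi>\<^sub>E p\<in>I. W p) \<and> ?u = (\<Sum>p\<in>I. w p)) = restrict w I"
    by (rule the1_equality) (use assms(3) in \<open>auto intro: sum.cong\<close>)
  then show ?thesis
    using assms(4) by (simp add: component_def)
qed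

lemma component_add:
  assumes D: "direct_sum scale U I W" and U: "subspace U" and ab: "a \<in> U" "b \<in> U" and p: "p \<in> I"
  shows "component I W p (a + b) = component I W p a + component I W p b"
proof -
  let ?w = "\<lambda>p. component I W p a + component I W p b"
  have s: "(\<Sum>p\<in>I. ?w p) = a + b"
    using D ab by (simp add: sum.distrib sum_component)
  have "?w q \<in> W q" if "q \<in> I" for q
    using that D ab component_mem[OF D] by (auto simp: direct_sum_def intro!: subspace_add)
  from component_unique[OF D _ this p] s show ?thesis
    using subspace_add[OF U ab] by simp
qed

lemma component_scale:
  assumes D: "direct_sum scale U I W" and U: "subspace U" and a: "a \<in> U" and p: "p \<in> I"
  shows "component I W p (scale c a) = scale c (component I W p a)"
proof -
  let ?w = "\<lambda>p. scale c (component I W p a)"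
  have s: "(\<Sum>p\<in>I. ?w p) = scale c a"
    using D a by (simp add: scale_sum_right[symmetric] sum_component)
  have "?w q \<in> W q" if "q \<in> I" for q
    using that D a component_mem[OF D] by (auto simp: direct_sum_def intro!: subspace_scale)
  from component_unique[OF D _ this p] s show ?thesis
    using subspace_scale[OF U a] by simp
qed

lemma component_of_summand:
  assumes D: "direct_sum scale U I W" and q: "q \<in> I" and u: "u \<in> W q" and p: "p \<in> I"
  shows "component I W p u = (if p = q then u else 0)"
proof -
  let ?w = "\<lambda>p. if p = q then u else 0"
  have "finite I" "u \<in> U"
    using D q u by (auto simp: direct_sum_def)
  then have s: "(\<Sum>p\<in>I. ?w p) = u"
    using q by simp
  have "?w p \<in> W p" if "p \<in> I" for p
    using that D u by (auto simp: direct_sum_def intro: subspace_0)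
  from component_unique[OF D _ this p] s \<open>u \<in> U\<close> show ?thesis
    by simp
qed

end

section \<open>The radical and the centroid of a multilinear form\<close>

locale nlinear_form = vector_space scale
  for scale :: "'k::field \<Rightarrow> 'v::ab_group_add \<Rightarrow> 'v" +
  fixes n :: nat and U :: "'v set" and F :: "'v list \<Rightarrow> 'k"
  assumes subspace_U: "subspace U"
    and multilinear: "multilinear_form scale n U F"
begin

lemma form_add:
  "xs \<in> tuples n U \<Longrightarrow> i < n \<Longrightarrow> a \<in> U \<Longrightarrow> b \<in> U \<Longrightarrow>
    F (xs[i := a + b]) = F (xs[i := a]) + F (xs[i := b])"
  using multilinear by (auto simp: multilinear_form_def)

lemma form_scale:
  "xs \<in> tuples n U \<Longrightarrow> i < n \<Longrightarrow> a \<in> U \<Longrightarrow> F (xs[i := scale c a]) = c * F (xs[i := a])"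
  using multilinear by (auto simp: multilinear_form_def)

lemma form_zero: "xs \<in> tuples n U \<Longrightarrow> i < n \<Longrightarrow> F (xs[i := 0]) = 0"
  using form_scale[of xs i 0 0] subspace_0[OF subspace_U] by simp

lemma form_sum:
  assumes "xs \<in> tuples n U" "i < n" "\<And>p. p \<in> I \<Longrightarrow> w p \<in> U"
  shows "F (xs[i := \<Sum>p\<in>I. w p]) = (\<Sum>p\<in>I. F (xs[i := w p]))"
  using assms(3)
proof (induction I rule: infinite_finite_induct)
  case (insert p I)
  then show ?case
    using assms(1,2) subspace_sum[OF subspace_U, of I w] by (simp add: form_add)
qed (use assms form_zero in auto)

lemma form_diff:
  assumes "xs \<in> tuples n U" "i < n" "a \<in> U" "b \<in> U"
  shows "F (xs[i := a - b]) = F (xs[i := a]) - F (xs[i := b])"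
  using form_add[of xs i "a - b" b] assms subspace_diff[OF subspace_U] by simp

lemma restriction: "subspace W \<Longrightarrow> W \<subseteq> U \<Longrightarrow> nlinear_form scale n W F"
  using multilinear tuples_mono[of W U n]
  by unfold_locales (auto simp: multilinear_form_def subset_iff)

lemma radical_subset: "radical n U F \<subseteq> U"
  by (auto simp: radical_def)

lemma subspace_radical: "subspace (radical n U F)"
  using subspace_U
  by (auto simp: subspace_def radical_def form_zero form_add form_scale)

lemma form_cong_radical:
  assumes xs: "xs \<in> tuples n U" and ys: "ys \<in> tuples n U"
    and d: "\<And>k. k < n \<Longrightarrow> ys ! k - xs ! k \<in> radical n U F"
  shows "F ys = F xs"
proof (rule eq_by_replacing_entries[OF xs ys])
  fix k zs assume k: "k < n" "zs \<in> tuples n U" "zs ! k = xs ! k"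
  have "F (zs[k := ys ! k]) - F (zs[k := xs ! k]) = F (zs[k := ys ! k - xs ! k])"
    using k xs ys by (simp add: form_diff tuples_nth)
  also have "\<dots> = 0"
    using k d by (simp add: radical_def)
  finally show "F (zs[k := ys ! k]) = F zs"
    using k(3)[symmetric] by simp
qed

lemma form_update_cong_radical:
  assumes xs: "xs \<in> tuples n U" and i: "i < n" and ab: "a \<in> U" "b \<in> U"
    and d: "a - b \<in> radical n U F"
  shows "F (xs[i := a]) = F (xs[i := b])"
  using form_diff[OF xs i ab] d xs i by (simp add: radical_def)

lemma centroid_intro:
  assumes "\<And>u. u \<in> U \<Longrightarrow> T u \<in> U"
    and "\<And>a b. a \<in> U \<Longrightarrow> b \<in> U \<Longrightarrow> T (a + b) = T a + T b"
    and "\<And>c a. a \<in> U \<Longrightarrow> T (scale c a) = scale c (T a)"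
    and "\<And>xs i j. xs \<in> tuples n U \<Longrightarrow> i < n \<Longrightarrow> j < n \<Longrightarrow>
          F (xs[i := T (xs ! i)]) = F (xs[j := T (xs ! j)])"
  shows "T \<in> centroid scale n U F"
  unfolding centroid_def using assms by blast

lemma centroid_mem: "T \<in> centroid scale n U F \<Longrightarrow> u \<in> U \<Longrightarrow> T u \<in> U"
  by (auto simp: centroid_def)

lemma centroid_add:
  "T \<in> centroid scale n U F \<Longrightarrow> a \<in> U \<Longrightarrow> b \<in> U \<Longrightarrow> T (a + b) = T a + T b"
  by (simp add: centroid_def)

lemma centroid_scale:
  "T \<in> centroid scale n U F \<Longrightarrow> a \<in> U \<Longrightarrow> T (scale c a) = scale c (T a)"
  by (simp add: centroid_def)

lemma centroid_zero: "T \<in> centroid scale n U F \<Longrightarrow> T 0 = 0"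
  using centroid_scale[of T 0 0] subspace_0[OF subspace_U] by simp

lemma centroid_diff:
  assumes T: "T \<in> centroid scale n U F" and ab: "a \<in> U" "b \<in> U"
  shows "T (a - b) = T a - T b"
proof -
  have "a - b \<in> U"
    using subspace_diff[OF subspace_U] ab by blast
  from centroid_add[OF T this ab(2)] have "T ((a - b) + b) = T (a - b) + T b" .
  then show ?thesis
    by simp
qed

lemma centroid_sum:
  assumes T: "T \<in> centroid scale n U F" and w: "\<And>p. p \<in> I \<Longrightarrow> w p \<in> U"
  shows "T (\<Sum>p\<in>I. w p) = (\<Sum>p\<in>I. T (w p))"
  using w
proof (induction I rule: infinite_finite_induct)
  case (insert p I)
  then have "w p \<in> U" "(\<Sum>p\<in>I. w p) \<in> U"
    by (auto intro: subspace_sum[OF subspace_U])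
  then show ?case
    using insert by (simp add: centroid_add[OF T])
qed (simp_all add: centroid_zero[OF T])

lemma centroid_shift:
  "T \<in> centroid scale n U F \<Longrightarrow> xs \<in> tuples n U \<Longrightarrow> i < n \<Longrightarrow> j < n \<Longrightarrow>
    F (xs[i := T (xs ! i)]) = F (xs[j := T (xs ! j)])"
  unfolding centroid_def by blast

lemma centroid_move:
  assumes T: "T \<in> centroid scale n U F" and xs: "xs \<in> tuples n U"
    and ij: "i < n" "j < n" and a: "a \<in> U"
  shows "i \<noteq> j \<Longrightarrow> F (xs[i := T a]) = F (xs[i := a, j := T (xs ! j)])"
proof -
  assume ne: "i \<noteq> j"
  have "xs[i := a] \<in> tuples n U"
    using xs a by (rule tuples_update)
  then have "F (xs[i := a, i := T (xs[i := a] ! i)]) = F (xs[i := a, j := T (xs[i := a] ! j)])"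
    using ij by (rule centroid_shift[OF T])
  then show ?thesis
    using ij ne tuples_length[OF xs] by simp
qed

text \<open>
  This is where three arguments are needed. To exchange \<open>S\<close> and \<open>T\<close> at position \<open>a\<close>, the outer operator
  \<open>S\<close> moves to a position \<open>b\<close>, then \<open>T\<close> moves to a third position \<open>c\<close>, and both return to \<open>a\<close>,
  \<open>S\<close> first.
\<close>

lemma centroid_commute:
  assumes n: "n \<ge> 3" and S: "S \<in> centroid scale n U F" and T: "T \<in> centroid scale n U F"
    and u: "u \<in> U"
  shows "S (T u) - T (S u) \<in> radical n U F"
proof -
  note mem = centroid_mem[OF S] centroid_mem[OF T]
  have "F (xs[a := S (T u) - T (S u)]) = 0" if xs: "xs \<in> tuples n U" and a: "a < n" for xs a
  proof -
    have "\<exists>b c. b < n \<and> c < n \<and> b \<noteq> a \<and> c \<noteq> a \<and> b \<noteq> c"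
    proof -
      have "card {..<n} \<ge> 3"
        using n by simp
      then have "card ({..<n} - {a}) \<ge> 2"
        using a by (simp add: card_Diff_singleton_if)
      then obtain B where "B \<subseteq> {..<n} - {a}" "card B = 2"
        using obtain_subset_with_card_n by metis
      then show ?thesis
        by (auto simp: card_2_iff)
    qed
    then obtain b c where bc: "b < n" "c < n" "b \<noteq> a" "c \<noteq> a" "b \<noteq> c"
      by blast
    have "F (xs[a := S (T u)]) = F (xs[b := S (xs ! b), a := T u])"
      using centroid_move[OF S xs a bc(1), of "T u"] bc u mem by (simp add: list_update_swap)
    also have "\<dots> = F (xs[b := S (xs ! b), c := T (xs ! c), a := u])"
      using centroid_move[OF T _ a bc(2) u, of "xs[b := S (xs ! b)]"] bc xs mem
      by (simp add: list_update_swap tuples_update tuples_nth)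
    also have "\<dots> = F (xs[c := T (xs ! c), a := S u])"
      using centroid_move[OF S _ a bc(1) u, of "xs[c := T (xs ! c)]"] bc xs mem
      by (simp add: list_update_swap tuples_update tuples_nth)
    also have "\<dots> = F (xs[a := T (S u)])"
      using centroid_move[OF T xs a bc(2), of "S u"] bc u mem by (simp add: list_update_swap)
    finally show ?thesis
      using form_diff[OF xs a] u mem by simp
  qed
  then show ?thesis
    using u mem subspace_diff[OF subspace_U] by (simp add: radical_def)
qed

text \<open>
  Expanding a second argument \<open>x\<^sub>j\<close> into its components shows
  \<open>F(\<dots>, P x\<^sub>i, \<dots>, x\<^sub>j, \<dots>) = F(\<dots>, P x\<^sub>i, \<dots>, P x\<^sub>j, \<dots>)\<close>, because mixed terms vanish, and the right-hand
  side is symmetric in \<open>i\<close> and \<open>j\<close>.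
\<close>

lemma component_in_centroid:
  assumes D: "form_direct_sum scale n U F I W G" and p: "p \<in> I"
  shows "component I W p \<in> centroid scale n U F"
proof -
  let ?P = "component I W"
  have ds: "direct_sum scale U I W"
    using D by (simp add: form_direct_sum_def)
  then have fin: "finite I"
    by (simp add: direct_sum_def)
  have mem: "?P q u \<in> W q" "?P q u \<in> U" if "q \<in> I" "u \<in> U" for q u
    using that component_mem[OF ds] ds by (auto simp: direct_sum_def)
  have both: "F (xs[i := ?P p (xs ! i)]) = F (xs[i := ?P p (xs ! i), j := ?P p (xs ! j)])"
    if xs: "xs \<in> tuples n U" and ij: "i < n" "j < n" "i \<noteq> j" for xs i j
  proof -
    let ?ys = "xs[i := ?P p (xs ! i)]"
    have ys: "?ys \<in> tuples n U"
      using xs ij p mem by (simp add: tuples_update tuples_nth)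
    have len: "length xs = n"
      using xs by (rule tuples_length)
    have "F ?ys = F (?ys[j := \<Sum>q\<in>I. ?P q (xs ! j)])"
      using sum_component[OF ds tuples_nth[OF xs ij(2)]] ij len by (simp add: list_update_swap)
    also have "\<dots> = (\<Sum>q\<in>I. F (?ys[j := ?P q (xs ! j)]))"
      using ys ij mem tuples_nth[OF xs] by (intro form_sum) auto
    also have "\<dots> = (\<Sum>q\<in>I. if q = p then F (?ys[j := ?P p (xs ! j)]) else 0)"
    proof (intro sum.cong refl)
      fix q assume q: "q \<in> I"
      let ?zs = "?ys[j := ?P q (xs ! j)]"
      have "?zs \<in> tuples n U" "?zs ! i \<in> W p" "?zs ! j \<in> W q"
        using ys xs ij len p q mem by (simp_all add: tuples_update tuples_nth)
      then have "q \<noteq> p \<Longrightarrow> F ?zs = 0"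
        using D p q ij unfolding form_direct_sum_def by blast
      then show "F ?zs = (if q = p then F (?ys[j := ?P p (xs ! j)]) else 0)"
        by simp
    qed
    also have "\<dots> = F (?ys[j := ?P p (xs ! j)])"
      using fin p by simp
    finally show ?thesis .
  qed
  show ?thesis
  proof (rule centroid_intro)
    fix xs i j assume xs: "xs \<in> tuples n U" and ij: "i < n" "j < n"
    show "F (xs[i := ?P p (xs ! i)]) = F (xs[j := ?P p (xs ! j)])"
    proof (cases "i = j")
      case False
      have "F (xs[i := ?P p (xs ! i)]) = F (xs[i := ?P p (xs ! i), j := ?P p (xs ! j)])"
        using xs ij False by (rule both)
      also have "\<dots> = F (xs[j := ?P p (xs ! j), i := ?P p (xs ! i)])"
        using False by (simp only: list_update_swap)
      also have "\<dots> = F (xs[j := ?P p (xs ! j)])"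
        using both[OF xs ij(2,1)] False by simp
      finally show ?thesis .
    qed simp
  qed (use mem p component_add[OF ds subspace_U] component_scale[OF ds subspace_U] in auto)
qed

section \<open>Indecomposable forms\<close>

text \<open>
  The form splits along the image and the kernel of \<open>E\<close>: if one argument lies in the image, \<open>E\<close> can be
  inserted there and moved to an argument in the kernel.
\<close>

lemma indecomposable_idempotent:
  assumes ind: "indecomposable_form scale n U F" and E: "E \<in> centroid scale n U F"
    and idem: "\<And>u. u \<in> U \<Longrightarrow> E (E u) = E u"
  shows "(\<forall>u\<in>U. E u = 0) \<or> (\<forall>u\<in>U. E u = u)"
proof -
  \<comment> \<open>The image of \<open>E\<close> on \<open>U\<close> is its set of fixed points.\<close>
  define W :: "nat \<Rightarrow> 'v set" where
    "W p = (if p = 1 then {u \<in> U. E u = u} else {u \<in> U. E u = 0})" for p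
  have lin: "E (a + b) = E a + E b" "E (scale c a) = scale c (E a)" if "a \<in> U" "b \<in> U" for a b c
    using that by (simp_all add: centroid_add[OF E] centroid_scale[OF E])
  have sub: "subspace (W p)" "W p \<subseteq> U" for p
    using subspace_U lin centroid_zero[OF E] by (auto simp: W_def subspace_def)
  have "\<exists>!w. w \<in> (\<Pi>\<^sub>E p\<in>{1, 2}. W p) \<and> u = (\<Sum>p\<in>{1, 2}. w p)" if u: "u \<in> U" for u
  proof -
    let ?w = "\<lambda>p\<in>{1, 2::nat}. if p = 1 then E u else u - E u"
    have Eu: "E u \<in> U" "E (E u) = E u" "u - E u \<in> U"
      using u centroid_mem[OF E u] idem[OF u] subspace_diff[OF subspace_U] by blast+
    then have "E (u - E u) = 0"
      using centroid_diff[OF E u Eu(1)] by simp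
    then have "E u \<in> W 1" "u - E u \<in> W 2"
      using Eu by (simp_all add: W_def)
    then have "?w \<in> (\<Pi>\<^sub>E p\<in>{1, 2}. W p) \<and> u = (\<Sum>p\<in>{1, 2}. ?w p)"
      by auto
    moreover have "w = ?w"
      if w: "w \<in> (\<Pi>\<^sub>E p\<in>{1, 2}. W p)" and sum: "u = (\<Sum>p\<in>{1, 2}. w p)" for w
    proof -
      have w12: "w 1 \<in> W 1" "w 2 \<in> W 2"
        using w by auto
      have u12: "u = w 1 + w 2"
        using sum by simp
      have "E (w 1 + w 2) = E (w 1) + E (w 2)"
        using w12 sub(2) by (intro lin(1)) blast+
      then have "E u = w 1"
        using w12 unfolding u12 by (simp add: W_def)
      moreover from this have "u - E u = w 2"
        using u12 by (metis add_diff_cancel_left')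
      ultimately show ?thesis
        using PiE_arb[OF w] by (intro ext) auto
    qed
    ultimately show ?thesis
      by blast
  qed
  then have ds: "direct_sum scale U {1, 2} W"
    using sub by (simp add: direct_sum_def)
  have vanish: "F xs = 0"
    if xs: "xs \<in> tuples n U" "i < n" "j < n" and ij: "xs ! i \<in> W 1" "xs ! j \<in> W 2" for xs i j
  proof -
    have "F xs = F (xs[i := E (xs ! i)])"
      using ij by (simp add: W_def)
    also have "\<dots> = F (xs[j := E (xs ! j)])"
      using E xs by (rule centroid_shift)
    also have "\<dots> = 0"
      using ij xs by (simp add: W_def form_zero)
    finally show ?thesis .
  qed
  have "form_direct_sum scale n U F {1, 2} W (\<lambda>_. F)"
    using ds vanish by (auto simp: form_direct_sum_def)
  then have "W 1 = {0} \<or> W 2 = {0}"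
    using ind by (auto simp: indecomposable_form_def)
  then show ?thesis
  proof
    assume "W 1 = {0}"
    then have "E u = 0" if "u \<in> U" for u
      using idem[OF that] centroid_mem[OF E that] by (auto simp: W_def)
    then show ?thesis by blast
  next
    assume W2: "W 2 = {0}"
    have "E u = u" if "u \<in> U" for u
    proof -
      have "u - E u \<in> W 2"
        using idem[OF that] centroid_mem[OF E that] centroid_diff[OF E that] that
          subspace_diff[OF subspace_U] by (auto simp: W_def)
      then show ?thesis using W2 by simp
    qed
    then show ?thesis by blast
  qed
qed

text \<open>
  Let \<open>g\<close> be a linear projection onto the radical. Then \<open>1 - g\<close> changes arguments only by elements of
  the radical, so inserting it does not change \<open>F\<close> at all; in particular it is a central idempotent.
  It vanishes only if \<open>F = 0\<close>, and it is the identity only if the radical is \<open>0\<close>.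
\<close>

lemma radical_eq_zero:
  assumes ind: "indecomposable_form scale n U F" and nz: "\<not> zero_form n U F" and n: "n > 0"
  shows "radical n U F = {0}"
proof -
  let ?R = "radical n U F"
  interpret vector_space_pair scale scale ..
  obtain g where g: "g ` UNIV \<subseteq> ?R" "Vector_Spaces.linear scale scale g" "\<forall>v\<in>?R. g v = v"
    using linear_exists_left_inverse_on[OF linear_id subspace_radical] by auto
  interpret g: Vector_Spaces.linear scale scale g by fact
  define E where "E u = u - g u" for u
  have gR: "g u \<in> ?R" for u
    using g(1) by blast
  have EU: "E u \<in> U" if "u \<in> U" for u
    using that gR radical_subset subspace_diff[OF subspace_U] by (auto simp: E_def)
  have FE: "F (xs[i := E (xs ! i)]) = F xs" if xs: "xs \<in> tuples n U" and i: "i < n" for xs i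
  proof -
    have "E (xs ! i) - xs ! i \<in> ?R"
      using subspace_neg[OF subspace_radical gR] by (simp add: E_def)
    from form_update_cong_radical[OF xs i EU _ this] show ?thesis
      using tuples_nth[OF xs i] by simp
  qed
  have "E \<in> centroid scale n U F"
  proof (rule centroid_intro)
    show "F (xs[i := E (xs ! i)]) = F (xs[j := E (xs ! j)])"
      if "xs \<in> tuples n U" "i < n" "j < n" for xs i j
      by (simp only: FE that)
  qed (use EU in \<open>simp_all add: E_def g.add g.scale scale_right_diff_distrib\<close>)
  moreover have "E (E u) = E u" for u
    using g(3) gR by (simp add: E_def g.diff)
  ultimately consider "\<forall>u\<in>U. E u = 0" | "\<forall>u\<in>U. E u = u"
    using indecomposable_idempotent[OF ind] by blast
  then show ?thesis
  proof cases
    case 1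
    have "F xs = 0" if xs: "xs \<in> tuples n U" for xs
      using FE[OF xs n] form_zero[OF xs n] 1 tuples_nth[OF xs n] by simp
    with nz show ?thesis by (simp add: zero_form_def)
  next
    case 2
    then have "v = 0" if "v \<in> ?R" for v
      using that g(3) radical_subset by (force simp: E_def)
    then show ?thesis
      using subspace_0[OF subspace_radical] by auto
  qed
qed

end

lemma indecomposable_form_cong:
  assumes "\<forall>xs\<in>tuples n W. G xs = F xs" and "indecomposable_form scale n W G"
  shows "indecomposable_form scale n W F"
  unfolding indecomposable_form_def
proof (intro allI impI)
  fix X :: "nat \<Rightarrow> _" and H
  assume D: "form_direct_sum scale n W F {1, 2} X H"
  then have "X 1 \<subseteq> W" "X 2 \<subseteq> W"
    by (auto simp: form_direct_sum_def direct_sum_def)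
  then have "form_direct_sum scale n W G {1, 2} X H"
    using D assms(1) tuples_mono[of "X 1" W n] tuples_mono[of "X 2" W n]
    by (auto simp: form_direct_sum_def)
  then show "X 1 = {0} \<or> X 2 = {0}"
    using assms(2) by (auto simp: indecomposable_form_def)
qed

section \<open>A decomposition into indecomposable summands and a zero form\<close>

locale indecomposable_decomposition = nlinear_form scale n U F
  for scale :: "'k::field \<Rightarrow> 'v::ab_group_add \<Rightarrow> 'v" and n U F +
  fixes s :: nat and Us :: "nat \<Rightarrow> 'v set" and Fs :: "nat \<Rightarrow> 'v list \<Rightarrow> 'k"
  assumes n_ge_3: "n \<ge> 3"
    and decomposition: "form_direct_sum scale n U F {0..s} Us Fs"
    and zero_summand: "zero_form n (Us 0) (Fs 0)"
    and summand: "\<forall>i\<in>{1..s}. \<not> zero_form n (Us i) (Fs i) \<and> indecomposable_form scale n (Us i) (Fs i)"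
begin

abbreviation P :: "nat \<Rightarrow> 'v \<Rightarrow> 'v" where "P \<equiv> component {0..s} Us"
abbreviation R :: "'v set" where "R \<equiv> radical n U F"

lemma direct: "direct_sum scale U {0..s} Us"
  using decomposition by (simp add: form_direct_sum_def)

lemma summand_subspace: "i \<le> s \<Longrightarrow> subspace (Us i)" "i \<le> s \<Longrightarrow> Us i \<subseteq> U"
  using direct by (auto simp: direct_sum_def)

lemma summand_form: "i \<le> s \<Longrightarrow> xs \<in> tuples n (Us i) \<Longrightarrow> Fs i xs = F xs"
  using decomposition by (simp add: form_direct_sum_def)

lemma P_centroid: "i \<le> s \<Longrightarrow> P i \<in> centroid scale n U F"
  using component_in_centroid[OF decomposition] by simp

lemma P_mem: "i \<le> s \<Longrightarrow> u \<in> U \<Longrightarrow> P i u \<in> Us i"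
  using component_mem[OF direct] by simp

lemma P_summand: "i \<le> s \<Longrightarrow> j \<le> s \<Longrightarrow> u \<in> Us j \<Longrightarrow> P i u = (if i = j then u else 0)"
  using component_of_summand[OF direct] by simp

lemma indecomposable_summand:
  assumes "i \<in> {1..s}"
  shows "indecomposable_form scale n (Us i) F" and "\<not> zero_form n (Us i) F"
  using assms summand summand_form[of i] indecomposable_form_cong[of n "Us i" "Fs i" F scale]
  by (force simp: zero_form_def)+

lemma summand_nonzero: "i \<in> {1..s} \<Longrightarrow> \<exists>u\<in>Us i. u \<noteq> 0"
proof (rule ccontr)
  assume i: "i \<in> {1..s}" and z: "\<not> (\<exists>u\<in>Us i. u \<noteq> 0)"
  interpret W: nlinear_form scale n "Us i" F
    using i by (intro restriction summand_subspace) auto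
  have "F xs = 0" if "xs \<in> tuples n (Us i)" for xs
  proof -
    have "xs ! 0 = 0"
      using z tuples_nth[OF that, of 0] n_ge_3 by auto
    then show ?thesis
      using W.form_zero[OF that, of 0] n_ge_3 by (metis list_update_id less_le_trans zero_less_numeral)
  qed
  then show False
    using indecomposable_summand[OF i] by (auto simp: zero_form_def)
qed

text \<open>
  A vector of the radical has its \<open>i\<close>-th component in the radical of the \<open>i\<close>-th summand, which is \<open>0\<close>
  for \<open>i \<ge> 1\<close>. Conversely, if one argument lies in the zero summand, then the other arguments may
  be replaced by their \<open>0\<close>-th components, and the form vanishes on the zero summand.
\<close>

lemma radical_eq_summand: "R = Us 0"
proof (intro equalityI subsetI)
  fix u assume u: "u \<in> R"
  then have uU: "u \<in> U"
    using radical_subset by blast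
  have "P i u = 0" if i: "i \<in> {1..s}" for i
  proof -
    interpret W: nlinear_form scale n "Us i" F
      using i by (intro restriction summand_subspace) auto
    have "F (xs[k := P i u]) = 0" if xs: "xs \<in> tuples n (Us i)" and k: "k < n" for xs k
    proof -
      have xsU: "xs \<in> tuples n U"
        using xs i tuples_mono[OF summand_subspace(2)] by auto
      obtain j where j: "j < n" "j \<noteq> k"
        using n_ge_3 by (metis One_nat_def less_le_trans numeral_3_eq_3 zero_less_Suc zero_neq_one Suc_less_eq)
      have "F (xs[k := P i u]) = F (xs[k := u, j := P i (xs ! j)])"
        using centroid_move[OF P_centroid xsU k j(1) uU] i j by auto
      also have "\<dots> = F (xs[j := P i (xs ! j), k := u])"
        using j by (simp add: list_update_swap)
      also have "\<dots> = 0"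
      proof -
        have "P i (xs ! j) \<in> U"
          using i j tuples_nth[OF xsU] by (intro centroid_mem[OF P_centroid]) auto
        then show ?thesis
          using u k tuples_update[OF xsU] by (simp add: radical_def)
      qed
      finally show ?thesis .
    qed
    then have "P i u \<in> radical n (Us i) F"
      using i P_mem[of i u] uU by (simp add: radical_def)
    then show ?thesis
      using W.radical_eq_zero indecomposable_summand[OF i] n_ge_3 by auto
  qed
  then have "(\<Sum>i\<in>{0..s}. P i u) = (\<Sum>i\<in>{0..s}. if i = 0 then P 0 u else 0)"
    by (intro sum.cong) auto
  then have "u = P 0 u"
    using sum_component[OF direct uU] by simp
  then show "u \<in> Us 0"
    using P_mem[of 0 u] uU by simp
next
  fix u assume u: "u \<in> Us 0"
  then have uU: "u \<in> U"
    using summand_subspace[of 0] by auto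
  have "F (xs[i := u]) = 0" if xs: "xs \<in> tuples n U" and i: "i < n" for xs i
  proof -
    let ?ys = "xs[i := u]"
    have ys: "?ys \<in> tuples n U" and yi: "?ys ! i = u"
      using xs uU i by (simp_all add: tuples_update tuples_length)
    have Pys: "map (P 0) ?ys \<in> tuples n (Us 0)"
      using ys P_mem[of 0] by (auto intro: tuples_map)
    have Pu: "P 0 u = u"
      using P_summand[of 0 0] u by simp
    have "F (map (P 0) ?ys) = F ?ys"
    proof (rule eq_by_replacing_entries[OF ys])
      show "map (P 0) ?ys \<in> tuples n U"
        using Pys tuples_mono[OF summand_subspace(2)[of 0]] by auto
    next
      fix k zs
      assume k: "k < n" and zs: "zs \<in> tuples n U"
        and zs_nth: "\<forall>m<n. zs ! m \<in> {?ys ! m, map (P 0) ?ys ! m}" and zk: "zs ! k = ?ys ! k"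
      have "F (zs[k := P 0 (zs ! k)]) = F (zs[i := P 0 (zs ! i)])"
        using zs k i by (intro centroid_shift P_centroid) auto
      moreover have "zs ! i = u"
        using zs_nth i yi Pu tuples_length[OF xs] by auto
      ultimately show "F (zs[k := map (P 0) ?ys ! k]) = F zs"
        using Pu zk k tuples_length[OF xs] by (metis list_update_id nth_map length_list_update)
    qed
    also have "F (map (P 0) ?ys) = 0"
      using zero_summand Pys summand_form[of 0] by (auto simp: zero_form_def)
    finally show ?thesis by simp
  qed
  then show "u \<in> R"
    using uU by (simp add: radical_def)
qed

lemma P_radical: "i \<in> {1..s} \<Longrightarrow> u \<in> R \<Longrightarrow> P i u = 0"
  using P_summand[of i 0 u] radical_eq_summand by simp

lemma P_cong_radical:
  assumes "i \<in> {1..s}" "a \<in> U" "b \<in> U" "a - b \<in> R"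
  shows "P i a = P i b"
  using assms centroid_diff[OF P_centroid, of i a b] P_radical[of i "a - b"] by simp

end

section \<open>Matching two decompositions\<close>

locale two_decompositions =
  A: indecomposable_decomposition scale n U F s Us Fs +
  B: indecomposable_decomposition scale n U F r Vs Gs
  for scale :: "'k::field \<Rightarrow> 'v::ab_group_add \<Rightarrow> 'v" and n U F s Us Fs r Vs Gs
begin

text \<open>
  Indices \<open>i\<close> and \<open>j\<close> are matched when the projection onto \<open>V\<^sub>j\<close> moves vectors of \<open>U\<^sub>i\<close> only by elements
  of the radical. Such a \<open>j\<close> is one for which \<open>P\<^sub>i Q\<^sub>j\<close> does not vanish on \<open>U\<^sub>i\<close>. As above, \<open>P\<^sub>i\<close> and \<open>Q\<^sub>j\<close>
  denote the projections \<open>A.P i\<close> and \<open>B.P j\<close>.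
\<close>

lemma exists_match:
  assumes i: "i \<in> {1..s}"
  shows "\<exists>j\<in>{1..r}. \<forall>x\<in>Us i. B.P j x - x \<in> A.R"
proof -
  have le: "i \<le> s" using i by simp
  note sub = A.summand_subspace(2)[OF le]
  interpret W: nlinear_form scale n "Us i" F
    using le by (intro A.restriction A.summand_subspace)
  have QU: "B.P j u \<in> U" if "j \<le> r" "u \<in> U" for j u
    using that A.centroid_mem[OF B.P_centroid] by blast
  have PU: "A.P i u \<in> U" if "u \<in> U" for u
    using that A.centroid_mem[OF A.P_centroid[OF le]] by blast
  have comm: "A.P i (B.P j u) - B.P j (A.P i u) \<in> A.R" if "j \<le> r" "u \<in> U" for j u
    using A.centroid_commute[OF A.n_ge_3 A.P_centroid[OF le] B.P_centroid] that by blast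
  have PQ: "A.P i (B.P j x) - B.P j x \<in> A.R" if "j \<le> r" "x \<in> Us i" for j x
    using comm[of j x] that sub A.P_summand[OF le le, of x] by auto
  \<comment> \<open>Modulo the radical, \<open>P\<^sub>i Q\<^sub>j\<close> agrees with \<open>Q\<^sub>j\<close> on \<open>U\<^sub>i\<close>, so it inherits centrality from \<open>Q\<^sub>j\<close>. It is
    exactly idempotent there, since the outer \<open>P\<^sub>i\<close> kills the error term.\<close>
  have dich: "(\<forall>x\<in>Us i. A.P i (B.P j x) = 0) \<or> (\<forall>x\<in>Us i. A.P i (B.P j x) = x)"
    if j: "j \<le> r" for j
  proof (rule W.indecomposable_idempotent[OF A.indecomposable_summand(1)[OF i]])
    let ?E = "\<lambda>x. A.P i (B.P j x)"
    have lin: "?E (a + b) = ?E a + ?E b" "?E (scale c a) = scale c (?E a)"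
      if "a \<in> U" "b \<in> U" for a b c
      using that QU[OF j] A.centroid_add[OF A.P_centroid[OF le]] A.centroid_add[OF B.P_centroid[OF j]]
        A.centroid_scale[OF A.P_centroid[OF le]] A.centroid_scale[OF B.P_centroid[OF j]]
      by simp_all
    have FE: "F (xs[k := ?E (xs ! k)]) = F (xs[k := B.P j (xs ! k)])"
      if xs: "xs \<in> tuples n (Us i)" and k: "k < n" for xs k
    proof (rule A.form_update_cong_radical)
      have x: "xs ! k \<in> Us i" using xs k by (rule tuples_nth)
      show "xs \<in> tuples n U" using xs tuples_mono[OF sub] by auto
      show "?E (xs ! k) \<in> U" "B.P j (xs ! k) \<in> U"
        using x sub PU QU[OF j] by auto
      show "?E (xs ! k) - B.P j (xs ! k) \<in> A.R" using PQ[OF j x] .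
    qed (rule k)
    have shift: "F (xs[k := ?E (xs ! k)]) = F (xs[l := ?E (xs ! l)])"
      if xs: "xs \<in> tuples n (Us i)" and kl: "k < n" "l < n" for xs k l
    proof -
      have "xs \<in> tuples n U"
        using xs tuples_mono[OF sub] by auto
      from A.centroid_shift[OF B.P_centroid[OF j] this kl] show ?thesis
        by (simp only: FE[OF xs] kl)
    qed
    show "?E \<in> centroid scale n (Us i) F"
    proof (rule W.centroid_intro)
      show "?E u \<in> Us i" if "u \<in> Us i" for u
        using that sub A.P_mem[OF le] QU[OF j] by blast
      show "?E (a + b) = ?E a + ?E b" if "a \<in> Us i" "b \<in> Us i" for a b
        using that sub by (intro lin) auto
      show "?E (scale c a) = scale c (?E a)" if "a \<in> Us i" for c a
        using that sub by (intro lin) auto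
    qed (fact shift)
    show "?E (?E x) = ?E x" if x: "x \<in> Us i" for x
    proof -
      have xU: "x \<in> U" using x sub by auto
      have Qx: "B.P j (B.P j x) = B.P j x"
        using B.P_summand[OF j j] B.P_mem[OF j xU] by simp
      have PP: "A.P i (?E x) = ?E x"
        using A.P_summand[OF le le] A.P_mem[OF le QU[OF j xU]] by simp
      have "A.P i (B.P j x) - B.P j (?E x) \<in> A.R"
        using comm[OF j QU[OF j xU]] Qx by simp
      from A.P_cong_radical[OF i _ _ this] show ?thesis
        using PP xU PU QU[OF j] by simp
    qed
  qed
  obtain x where x: "x \<in> Us i" "x \<noteq> 0"
    using A.summand_nonzero[OF i] by blast
  then have xU: "x \<in> U" using sub by auto
  have "\<exists>j\<in>{1..r}. A.P i (B.P j x) \<noteq> 0"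
  proof (rule ccontr)
    assume z: "\<not> (\<exists>j\<in>{1..r}. A.P i (B.P j x) \<noteq> 0)"
    \<comment> \<open>Then all terms of \<open>x = P\<^sub>i x = \<Sum>\<^sub>j P\<^sub>i Q\<^sub>j x\<close> vanish, the one for \<open>j = 0\<close> because \<open>V\<^sub>0\<close> is the
      radical.\<close>
    have "A.P i (B.P 0 x) = 0"
      using A.P_radical[OF i] B.radical_eq_summand B.P_mem[of 0 x] xU by simp
    then have z: "A.P i (B.P j x) = 0" if "j \<in> {0..r}" for j
      using z that by (cases "j = 0") auto
    have "A.P i x = (\<Sum>j\<in>{0..r}. A.P i (B.P j x))"
      using A.centroid_sum[OF A.P_centroid[OF le], of "{0..r}" "\<lambda>j. B.P j x"] QU xU
        A.sum_component[OF B.direct xU] by simp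
    then have "A.P i x = 0"
      using z by simp
    then show False
      using A.P_summand[OF le le x(1)] x(2) by simp
  qed
  then obtain j where j: "j \<in> {1..r}" "A.P i (B.P j x) \<noteq> 0" by blast
  then have id: "A.P i (B.P j y) = y" if "y \<in> Us i" for y
    using dich[of j] x that by auto
  have "B.P j y - y \<in> A.R" if "y \<in> Us i" for y
    using A.subspace_neg[OF A.subspace_radical PQ[of j y]] that id[OF that] j by simp
  with j(1) show ?thesis by blast
qed

text \<open>
  For \<open>x \<in> U\<^sub>i\<close> the hypotheses give \<open>P\<^sub>k x \<equiv> P\<^sub>k Q\<^sub>j x \<equiv> Q\<^sub>j x \<equiv> x\<close> modulo the radical, whereas \<open>P\<^sub>k x = 0\<close> if
  \<open>k \<noteq> i\<close>; and \<open>U\<^sub>i\<close> meets the radical \<open>U\<^sub>0\<close> only in \<open>0\<close>.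
\<close>

lemma match_back:
  assumes i: "i \<in> {1..s}" and j: "j \<in> {1..r}" and k: "k \<in> {1..s}"
    and ij: "\<forall>x\<in>Us i. B.P j x - x \<in> A.R" and jk: "\<forall>y\<in>Vs j. A.P k y - y \<in> A.R"
  shows "k = i"
proof (rule ccontr)
  assume ne: "k \<noteq> i"
  have le: "i \<le> s" "j \<le> r" "k \<le> s"
    using i j k by auto
  obtain x where x: "x \<in> Us i" "x \<noteq> 0"
    using A.summand_nonzero[OF i] by blast
  then have xU: "x \<in> U"
    using A.summand_subspace(2)[OF le(1)] by auto
  have y: "B.P j x \<in> Vs j" "B.P j x \<in> U"
    using B.P_mem[OF le(2) xU] B.summand_subspace(2)[OF le(2)] by auto
  have "A.P k (B.P j x) = 0"
    using A.P_cong_radical[OF k y(2) xU] ij x A.P_summand[OF le(3,1)] ne by auto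
  then have "- B.P j x \<in> A.R"
    using jk y(1) by force
  then have "- x \<in> A.R"
    using ij x(1) A.subspace_add[OF A.subspace_radical, of "- B.P j x" "B.P j x - x"] by simp
  then have "A.P i (- x) = 0"
    using A.P_radical[OF i] by blast
  moreover have "A.P i (- x) = - x"
    using A.P_summand[OF le(1,1)] x(1) A.subspace_neg[OF A.summand_subspace(1)[OF le(1)]] by simp
  ultimately show False
    using x(2) by simp
qed

lemma match_retract:
  assumes i: "i \<in> {1..s}" and j: "j \<in> {1..r}"
    and ij: "\<forall>x\<in>Us i. B.P j x - x \<in> A.R" and x: "x \<in> Us i"
  shows "A.P i (B.P j x) = x"
proof -
  have le: "i \<le> s" "j \<le> r"
    using i j by auto
  have xU: "x \<in> U"
    using x A.summand_subspace(2)[OF le(1)] by auto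
  have "A.P i (B.P j x) = A.P i x"
    using A.P_cong_radical[OF i _ xU] A.centroid_mem[OF B.P_centroid[OF le(2)] xU] ij x by auto
  then show ?thesis
    using A.P_summand[OF le(1,1) x] by simp
qed

lemma match_sum_subset:
  assumes i: "i \<in> {1..s}" and j: "j \<in> {1..r}"
    and ij: "\<forall>x\<in>Us i. B.P j x - x \<in> A.R"
  shows "Us i + Us 0 \<subseteq> Vs j + Vs 0"
proof
  fix u assume "u \<in> Us i + Us 0"
  then obtain x z where u: "u = x + z" and x: "x \<in> Us i" and z: "z \<in> A.R"
    using A.radical_eq_summand by (auto simp: set_plus_def)
  have "x \<in> U"
    using x i A.summand_subspace(2)[of i] by auto
  then have "B.P j x \<in> Vs j"
    using B.P_mem[of j] j by simp
  moreover have "z - (B.P j x - x) \<in> Vs 0"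
    using A.subspace_diff[OF A.subspace_radical z] ij x B.radical_eq_summand by blast
  ultimately have "B.P j x + (z - (B.P j x - x)) \<in> Vs j + Vs 0"
    by (rule set_plus_intro)
  then show "u \<in> Vs j + Vs 0"
    by (simp add: u add.commute)
qed

lemma swapped: "two_decompositions scale n U F r Vs Gs s Us Fs" ..

text \<open>
  The congruence is \<open>Q\<^sub>j\<close>, with inverse \<open>P\<^sub>i\<close>; it preserves \<open>F\<close> because it moves arguments only by
  elements of the radical.
\<close>

lemma match_congruent:
  assumes i: "i \<in> {1..s}" and j: "j \<in> {1..r}"
    and ij: "\<forall>x\<in>Us i. B.P j x - x \<in> A.R" and ji: "\<forall>y\<in>Vs j. A.P i y - y \<in> A.R"
  shows "congruent_forms scale n (Us i) (Fs i) (Vs j) (Gs j)"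
proof -
  have le: "i \<le> s" "j \<le> r"
    using i j by auto
  note subA = A.summand_subspace(2)[OF le(1)] and subB = B.summand_subspace(2)[OF le(2)]
  have mem: "B.P j x \<in> Vs j" if "x \<in> U" for x
    using that B.P_mem[OF le(2)] by blast
  have "bij_betw (B.P j) (Us i) (Vs j)"
    using match_retract[OF i j ij] two_decompositions.match_retract[OF swapped j i ji] mem A.P_mem[OF le(1)] subA subB
    by (intro bij_betw_byWitness[where f' = "A.P i"]) auto
  then have "linear_bijection scale (Us i) (Vs j) (B.P j)"
    using subA A.centroid_add[OF B.P_centroid[OF le(2)]] A.centroid_scale[OF B.P_centroid[OF le(2)]]
    by (auto simp: linear_bijection_def subset_iff)
  moreover have "Fs i xs = Gs j (map (B.P j) xs)" if xs: "xs \<in> tuples n (Us i)" for xs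
  proof -
    let ?ys = "map (B.P j) xs"
    have ys: "?ys \<in> tuples n (Vs j)"
      using xs mem subA by (auto intro: tuples_map)
    have "F ?ys = F xs"
    proof (rule A.form_cong_radical)
      show "xs \<in> tuples n U" "?ys \<in> tuples n U"
        using xs ys tuples_mono[OF subA] tuples_mono[OF subB] by auto
      show "?ys ! k - xs ! k \<in> A.R" if "k < n" for k
        using that ij tuples_nth[OF xs that] tuples_length[OF xs] by simp
    qed
    then show ?thesis
      using A.summand_form[OF le(1) xs] B.summand_form[OF le(2) ys] by simp
  qed
  ultimately show ?thesis
    by (auto simp: congruent_forms_def)
qed

text \<open>
  A match \<open>f i\<close> of each \<open>i\<close> and a match \<open>g j\<close> of each \<open>j\<close> are chosen independently; they are mutually
  inverse by \<open>match_back\<close>, and so matching is symmetric.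
\<close>

lemma uniqueness:
  "\<exists>f. bij_betw f {1..s} {1..r} \<and>
     (\<forall>i\<in>{1..s}. congruent_forms scale n (Us i) (Fs i) (Vs (f i)) (Gs (f i)) \<and>
        Us i + Us 0 = Vs (f i) + Vs 0)"
proof -
  obtain f where f: "\<And>i. i \<in> {1..s} \<Longrightarrow> f i \<in> {1..r}"
      "\<And>i. i \<in> {1..s} \<Longrightarrow> \<forall>x\<in>Us i. B.P (f i) x - x \<in> A.R"
    using exists_match by metis
  obtain g where g: "\<And>j. j \<in> {1..r} \<Longrightarrow> g j \<in> {1..s}"
      "\<And>j. j \<in> {1..r} \<Longrightarrow> \<forall>y\<in>Vs j. A.P (g j) y - y \<in> A.R"
    using two_decompositions.exists_match[OF swapped] by metis
  have gf: "g (f i) = i" if "i \<in> {1..s}" for i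
    by (rule match_back[OF that f(1)[OF that] _ f(2)[OF that]]) (use that f(1) g in blast)+
  have fg: "f (g j) = j" if "j \<in> {1..r}" for j
    by (rule two_decompositions.match_back[OF swapped that g(1)[OF that] _ g(2)[OF that]]) (use that g(1) f in blast)+
  have "bij_betw f {1..s} {1..r}"
    using f(1) g(1) gf fg by (intro bij_betw_byWitness[where f' = g]) blast+
  moreover have "congruent_forms scale n (Us i) (Fs i) (Vs (f i)) (Gs (f i)) \<and>
      Us i + Us 0 = Vs (f i) + Vs 0" if i: "i \<in> {1..s}" for i
  proof -
    have ji: "\<forall>y\<in>Vs (f i). A.P i y - y \<in> A.R"
      using g(2)[OF f(1)[OF i]] gf[OF i] by simp
    show ?thesis
      using match_congruent[OF i f(1)[OF i] f(2)[OF i] ji]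
        match_sum_subset[OF i f(1)[OF i] f(2)[OF i]] two_decompositions.match_sum_subset[OF swapped f(1)[OF i] i ji]
      by blast
  qed
  ultimately show ?thesis
    by blast
qed

end

theorem corollary11:
  fixes scale :: "'k::field \<Rightarrow> 'v::ab_group_add \<Rightarrow> 'v"
    and n s r :: nat
    and U :: "'v set"
    and F :: "'v list \<Rightarrow> 'k"
    and Us Vs :: "nat \<Rightarrow> 'v set"
    and Fs Gs :: "nat \<Rightarrow> 'v list \<Rightarrow> 'k"
  assumes "vector_space scale"
    and "module.subspace scale U"
    and "\<exists>B. finite B \<and> module.span scale B = U"
    and "n \<ge> 3"
    and "multilinear_form scale n U F"
    and "form_direct_sum scale n U F {0..s} Us Fs"
    and "zero_form n (Us 0) (Fs 0)"
    and "\<forall>i\<in>{1..s}. \<not> zero_form n (Us i) (Fs i) \<and> indecomposable_form scale n (Us i) (Fs i)"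
    and "form_direct_sum scale n U F {0..r} Vs Gs"
    and "zero_form n (Vs 0) (Gs 0)"
    and "\<forall>i\<in>{1..r}. \<not> zero_form n (Vs i) (Gs i) \<and> indecomposable_form scale n (Vs i) (Gs i)"
  shows "r = s \<and> Vs 0 = Us 0 \<and>
    (\<exists>\<pi>. bij_betw \<pi> {1..s} {1..s} \<and>
      (\<forall>i\<in>{1..s}.
        congruent_forms scale n (Us i) (Fs i) (Vs (\<pi> i)) (Gs (\<pi> i)) \<and>
        Us i + Us 0 = Vs (\<pi> i) + Vs 0))"
proof -
  interpret two_decompositions scale n U F s Us Fs r Vs Gs
    using assms
    by (simp add: two_decompositions_def indecomposable_decomposition_def
        indecomposable_decomposition_axioms_def nlinear_form_def nlinear_form_axioms_def)
  obtain f where f: "bij_betw f {1..s} {1..r}"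
      "\<forall>i\<in>{1..s}. congruent_forms scale n (Us i) (Fs i) (Vs (f i)) (Gs (f i)) \<and>
        Us i + Us 0 = Vs (f i) + Vs 0"
    using uniqueness by blast
  have "r = s"
    using bij_betw_same_card[OF f(1)] by simp
  moreover have "Vs 0 = Us 0"
    using A.radical_eq_summand B.radical_eq_summand by simp
  ultimately show ?thesis
    using f by blast
qed

end
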